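(* Let $G$ be a finite simple undirected graph. Then $G\in\mathcal{F}$ if and only if $G$ contains neither $P_4$ nor $\overline{K}_3$ as an induced subgraph, i.e., $G$ contains no induced path of length $3$ and no stable set of cardinality $3$.
   Context: $P_4$ is the path on $4$ vertices (length $3$), and $\overline{K}_3$ is the graph with three vertices and no edges. For an integer $k\ge 0$, $\mathcal{F}_k$ is the class of graphs whose vertex set can be partitioned into cliques $X_1,Y_1,\dots,X_k,Y_k,Z$, with $X_j\neq\emptyset$ and $Y_j\ne\emptyset$ for $j=1,\dots,k$ and $Z$ possibly empty, such that two vertices lying in different parts are non-adjacent if and only if, for some $j$, one lies in $X_j$ and the other in $Y_j$. (In particular $\mathcal{F}_0$ is the class of complete graphs.) Set $\mathcal{F}=\bigcup_{k=0}^\infty\mathcal{F}_k$. *)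

theory Defs
  imports "Graph_Theory.Graph_Theory" "HOL-Library.Disjoint_Sets"
begin

text \<open>
  Finite simple undirected graphs are the locale \<^locale>\<open>graph\<close>: finite, loop-free digraphs
  without parallel arcs whose arc relation is symmetric, so that an undirected edge is a pair of
  opposite arcs and adjacency of \<open>u\<close> and \<open>v\<close> is \<open>u \<rightarrow>\<^bsub>G\<^esub> v\<close>. The null graph is allowed.
\<close>

definition clique :: "('a, 'b) pre_digraph \<Rightarrow> 'a set \<Rightarrow> bool" where
  "clique G C \<longleftrightarrow> C \<subseteq> verts G \<and> (\<forall>u\<in>C. \<forall>v\<in>C. u \<noteq> v \<longrightarrow> u \<rightarrow>\<^bsub>G\<^esub> v)"

text \<open>
  The parts are indexed by formal names rather than collected in a set of sets, so that
  possibly empty parts cause no confusion.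
\<close>

datatype part = X_part nat | Y_part nat | Z_part

definition parts :: "nat \<Rightarrow> part set" where
  "parts k = X_part ` {1..k} \<union> Y_part ` {1..k} \<union> {Z_part}"

definition F_partition :: "nat \<Rightarrow> ('a, 'b) pre_digraph \<Rightarrow> (part \<Rightarrow> 'a set) \<Rightarrow> bool" where
  "F_partition k G P \<longleftrightarrow>
     (\<Union>p\<in>parts k. P p) = verts G \<and>
     disjoint_family_on P (parts k) \<and>
     (\<forall>p\<in>parts k. clique G (P p)) \<and>
     (\<forall>j\<in>{1..k}. P (X_part j) \<noteq> {} \<and> P (Y_part j) \<noteq> {}) \<and>
     (\<forall>p\<in>parts k. \<forall>q\<in>parts k. p \<noteq> q \<longrightarrow> (\<forall>u\<in>P p. \<forall>v\<in>P q.
        \<not> u \<rightarrow>\<^bsub>G\<^esub> v \<longleftrightarrow>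
        (\<exists>j\<in>{1..k}. u \<in> P (X_part j) \<and> v \<in> P (Y_part j) \<or> u \<in> P (Y_part j) \<and> v \<in> P (X_part j))))"

definition F_k :: "nat \<Rightarrow> ('a, 'b) pre_digraph set" where
  "F_k k = {G. graph G \<and> (\<exists>P. F_partition k G P)}"

definition F_class :: "('a, 'b) pre_digraph set" where
  "F_class = (\<Union>k. F_k k)"

definition path_graph :: "nat \<Rightarrow> nat pair_pre_digraph" where
  "path_graph n = \<lparr> pverts = {..<n}, parcs = {(i, j). i < n \<and> j < n \<and> (j = Suc i \<or> i = Suc j)} \<rparr>"

definition edgeless_graph :: "nat \<Rightarrow> nat pair_pre_digraph" where
  "edgeless_graph n = \<lparr> pverts = {..<n}, parcs = {} \<rparr>"

definition contains_induced :: "('a, 'b) pre_digraph \<Rightarrow> ('c, 'd) pre_digraph \<Rightarrow> bool" where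
  "contains_induced G H \<longleftrightarrow> (\<exists>K. induced_subgraph K G \<and> digraph_iso K H)"

end

theory Submission
  imports Defs
begin

text \<open>
  The theorem is best read in the complement. A graph lies in the class exactly when every
  connected component of its complement is a single vertex or a complete bipartite graph: the
  vertices of \<open>Z\<close> are the isolated vertices of the complement, and \<open>X\<^sub>j\<close>, \<open>Y\<^sub>j\<close> are the two sides
  of a nontrivial component. This condition on the complement is equivalent to the conjunction
  of two local ones: there is no triangle, and the ends of every walk of length three are
  adjacent (an odd walk connects opposite sides of a complete bipartite component).

  Each of the two directions passes through these local conditions. The absence of triangles in
  the complement is the absence of stable triples in the graph. In the absence of triangles, a
  walk of length three in the complement either repeats a vertex, and then its ends are already
  adjacent, or its ends are adjacent, or it is an induced path on four vertices; as the
  complement of such a path is again such a path, this last case is exactly what has to be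
  excluded (\<open>forbidden_subgraphs_iff\<close>). Given a partition, the sides tell at once that both
  conditions hold (\<open>F_partition_imp_local\<close>). Conversely, under the local conditions the
  component of a non-isolated vertex \<open>a\<close> of the complement consists of the neighbours of \<open>a\<close> and
  the neighbours of these neighbours; choosing one such \<open>a\<close> in each nontrivial component
  yields the parts (\<open>local_imp_F_partition\<close>).
\<close>

section \<open>Induced copies of a pair digraph\<close>

text \<open>
  An isomorphism of digraphs also has to map arcs to arcs. Without parallel arcs the arc map is
  determined by the vertex map, so an induced copy is just an embedding of the vertices.
\<close>

lemma (in nomulti_digraph) contains_induced_with_proj_iff:
  assumes "pair_wf_digraph H"
  shows "contains_induced G (with_proj H) \<longleftrightarrow>
    (\<exists>f. inj_on f (pverts H) \<and> f ` pverts H \<subseteq> verts G \<and>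
      (\<forall>i\<in>pverts H. \<forall>j\<in>pverts H. f i \<rightarrow>\<^bsub>G\<^esub> f j \<longleftrightarrow> (i, j) \<in> parcs H))"
    (is "?L \<longleftrightarrow> ?R")
proof
  assume ?L
  then obtain K hom where K: "induced_subgraph K G"
    and hom: "pre_digraph.digraph_isomorphism K hom" and H: "with_proj H = app_iso hom K"
    unfolding contains_induced_def digraph_iso_def by auto
  interpret K: wf_digraph K using K by (rule wf_digraphI_induced)
  define g where "g = iso_verts hom"
  define f where "f = the_inv_into (verts K) g"
  have inj: "inj_on g (verts K)"
    using hom unfolding g_def by (rule K.digraph_isomorphism_inj_on_verts)
  have V: "pverts H = g ` verts K" using arg_cong[OF H, of verts] by (simp add: g_def)
  have A: "parcs H = (\<lambda>(u, v). (g u, g v)) ` arcs_ends K"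
    using arg_cong[OF H, of arcs_ends] K.arcs_ends_app_iso_eq[OF hom] by (simp add: g_def)
  have bij: "bij_betw f (pverts H) (verts K)"
    unfolding f_def V using inj by (intro bij_betw_the_inv_into) (simp add: bij_betw_def)
  have sub: "verts K \<subseteq> verts G" and comp: "compatible G K" using K by auto
  have TK: "tail K = tail G" "head K = head G" using comp by (simp_all add: compatible_def)
  have AK: "arcs K = {e \<in> arcs G. tail G e \<in> verts K \<and> head G e \<in> verts K}"
    using K by (rule induced_subgraphE)
  have ends: "u \<rightarrow>\<^bsub>K\<^esub> v \<longleftrightarrow> u \<rightarrow>\<^bsub>G\<^esub> v" if "u \<in> verts K" "v \<in> verts K" for u v
    using that unfolding arcs_ends_conv image_iff AK TK by blast
  have "f i \<rightarrow>\<^bsub>G\<^esub> f j \<longleftrightarrow> (i, j) \<in> parcs H" if ij: "i \<in> pverts H" "j \<in> pverts H" for i j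
  proof -
    obtain u v where uv: "u \<in> verts K" "v \<in> verts K" "i = g u" "j = g v"
      using ij unfolding V by blast
    have "(i, j) \<in> parcs H \<longleftrightarrow> u \<rightarrow>\<^bsub>K\<^esub> v"
    proof
      assume "(i, j) \<in> parcs H"
      then obtain u' v' where e: "u' \<rightarrow>\<^bsub>K\<^esub> v'" "g u' = g u" "g v' = g v"
        using uv A by auto
      have "u' = u" "v' = v"
        using e inj uv K.adj_in_verts[OF e(1)] by (auto dest: inj_onD)
      then show "u \<rightarrow>\<^bsub>K\<^esub> v" using e by simp
    qed (use A uv in auto)
    moreover have "f i = u" "f j = v"
      using uv inj by (simp_all add: f_def the_inv_into_f_f)
    ultimately show ?thesis using ends uv by simp
  qed
  with bij sub show ?R by (intro exI[of _ f]) (simp add: bij_betw_def)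
next
  assume ?R
  then obtain f where inj: "inj_on f (pverts H)" and im: "f ` pverts H \<subseteq> verts G"
    and adj: "\<And>i j. i \<in> pverts H \<Longrightarrow> j \<in> pverts H \<Longrightarrow> f i \<rightarrow>\<^bsub>G\<^esub> f j \<longleftrightarrow> (i, j) \<in> parcs H"
    by blast
  interpret H: pair_wf_digraph H by fact
  define K where "K = G \<restriction> (f ` pverts H)"
  define g where "g = the_inv_into (pverts H) f"
  define hom where "hom = \<lparr> iso_verts = g, iso_arcs = (\<lambda>e. (g (tail G e), g (head G e))),
    iso_head = snd, iso_tail = fst \<rparr>"
  have gf: "g (f i) = i" if "i \<in> pverts H" for i
    using inj that by (simp add: g_def the_inv_into_f_f)
  have fg: "f (g u) = u" "g u \<in> pverts H" if "u \<in> f ` pverts H" for u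
    using that gf by auto
  have K: "induced_subgraph K G" unfolding K_def using im by (rule induced_induce)
  have VK: "verts K = f ` pverts H"
    and AK: "arcs K = {e \<in> arcs G. tail G e \<in> f ` pverts H \<and> head G e \<in> f ` pverts H}"
    and TK: "tail K = tail G" "head K = head G"
    by (auto simp: K_def induce_subgraph_def)
  have "inj_on (iso_arcs hom) (arcs K)"
  proof (rule inj_onI)
    fix e e' assume e: "e \<in> arcs K" "e' \<in> arcs K" "iso_arcs hom e = iso_arcs hom e'"
    then have "f (g (tail G e)) = f (g (tail G e'))" "f (g (head G e)) = f (g (head G e'))"
      by (simp_all add: hom_def)
    then have "arc_to_ends G e = arc_to_ends G e'"
      using e fg by (simp add: AK arc_to_ends_def)
    then show "e = e'" using e no_multi_arcs by (simp add: AK)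
  qed
  moreover have "inj_on g (f ` pverts H)" by (rule inj_on_inverseI) (rule fg)
  ultimately have iso: "pre_digraph.digraph_isomorphism K hom"
    using wf_digraphI_induced[OF K]
    by (simp add: pre_digraph.digraph_isomorphism_def VK TK hom_def)
  have "iso_arcs hom ` arcs K = parcs H"
  proof (intro equalityI subsetI)
    fix a assume "a \<in> iso_arcs hom ` arcs K"
    then obtain e i j where e: "e \<in> arcs G" "tail G e = f i" "head G e = f j"
      and ij: "i \<in> pverts H" "j \<in> pverts H" and a: "a = (i, j)"
      by (auto simp: AK hom_def gf)
    have "f i \<rightarrow>\<^bsub>G\<^esub> f j" using e dominatesI[of e] by (simp add: arc_to_ends_def)
    then show "a \<in> parcs H" using adj ij a by simp
  next
    fix a assume a: "a \<in> parcs H"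
    obtain i j where ij: "a = (i, j)" by (cases a)
    have V: "i \<in> pverts H" "j \<in> pverts H"
      using H.arc_fst_in_verts[OF a] H.arc_snd_in_verts[OF a] ij by auto
    then have "f i \<rightarrow>\<^bsub>G\<^esub> f j" using adj a ij by simp
    then obtain e where "e \<in> arcs G" "tail G e = f i" "head G e = f j" by (rule reachableE)
    then show "a \<in> iso_arcs hom ` arcs K"
      using V ij gf by (force simp: AK hom_def)
  qed
  moreover have "g ` f ` pverts H = pverts H" using gf by (force simp: image_image)
  ultimately have "with_proj H = app_iso hom K"
    by (simp add: app_iso_def with_proj_def VK) (simp add: hom_def)
  with iso K show ?L unfolding contains_induced_def digraph_iso_def by blast
qed

section \<open>Local conditions on the complement\<close>

definition nonadj :: "('a, 'b) pre_digraph \<Rightarrow> 'a \<Rightarrow> 'a \<Rightarrow> bool" where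
  "nonadj G u v \<longleftrightarrow> u \<in> verts G \<and> v \<in> verts G \<and> u \<noteq> v \<and> \<not> u \<rightarrow>\<^bsub>G\<^esub> v"

definition co_triangle_free :: "('a, 'b) pre_digraph \<Rightarrow> bool" where
  "co_triangle_free G \<longleftrightarrow> (\<nexists>a b c. nonadj G a b \<and> nonadj G b c \<and> nonadj G a c)"

definition co_three_walks_close :: "('a, 'b) pre_digraph \<Rightarrow> bool" where
  "co_three_walks_close G \<longleftrightarrow>
    (\<forall>a b c d. nonadj G a b \<longrightarrow> nonadj G b c \<longrightarrow> nonadj G c d \<longrightarrow> nonadj G a d)"

lemma (in sym_digraph) adj_sym: "u \<rightarrow>\<^bsub>G\<^esub> v \<longleftrightarrow> v \<rightarrow>\<^bsub>G\<^esub> u"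
  using arcs_ends_symmetric[OF sym_arcs] by blast

lemma (in sym_digraph) nonadj_sym: "nonadj G u v \<longleftrightarrow> nonadj G v u"
  using adj_sym unfolding nonadj_def by blast

lemma path_graph_wf: "pair_wf_digraph (path_graph n)"
  by unfold_locales (auto simp: path_graph_def)

lemma edgeless_graph_wf: "pair_wf_digraph (edgeless_graph n)"
  by unfold_locales (auto simp: edgeless_graph_def)

lemma (in graph) contains_edgeless_3_iff:
  "contains_induced G (with_proj (edgeless_graph 3)) \<longleftrightarrow> \<not> co_triangle_free G"
proof
  have V: "pverts (edgeless_graph 3) = {0, 1, 2}" by (auto simp: edgeless_graph_def)
  have A: "parcs (edgeless_graph 3) = {}" by (simp add: edgeless_graph_def)
  {
    assume "contains_induced G (with_proj (edgeless_graph 3))"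
    then obtain f :: "nat \<Rightarrow> 'a" where "inj_on f {0, 1, 2}" "f ` {0, 1, 2} \<subseteq> verts G"
      "\<forall>i\<in>{0, 1, 2}. \<forall>j\<in>{0, 1, 2}. \<not> f i \<rightarrow>\<^bsub>G\<^esub> f j"
      unfolding contains_induced_with_proj_iff[OF edgeless_graph_wf] V A by auto
    then have "nonadj G (f 0) (f 1)" "nonadj G (f 1) (f 2)" "nonadj G (f 0) (f 2)"
      by (auto simp: nonadj_def)
    then show "\<not> co_triangle_free G" unfolding co_triangle_free_def by blast
  next
    assume "\<not> co_triangle_free G"
    then obtain a b c where abc: "nonadj G a b" "nonadj G b c" "nonadj G a c"
      unfolding co_triangle_free_def by blast
    define f :: "nat \<Rightarrow> 'a" where "f i = [a, b, c] ! i" for i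
    have f: "f 0 = a" "f (Suc 0) = b" "f 2 = c" by (simp_all add: f_def)
    show "contains_induced G (with_proj (edgeless_graph 3))"
      unfolding contains_induced_with_proj_iff[OF edgeless_graph_wf] V A
      by (rule exI[of _ f]) (use abc adj_not_same adj_sym in \<open>auto simp: f nonadj_def\<close>)
  }
qed

text \<open>
  The complement of the path \<open>0, 1, 2, 3\<close> is the path \<open>1, 3, 0, 2\<close>, a walk of length three whose
  ends are adjacent in the given graph.
\<close>

lemma (in graph) contains_path_4_imp:
  assumes "contains_induced G (with_proj (path_graph 4))"
  shows "\<not> co_three_walks_close G"
proof -
  obtain f :: "nat \<Rightarrow> 'a" where inj: "inj_on f {..<4}" and im: "f ` {..<4} \<subseteq> verts G"
    and adj: "\<And>i j. i < 4 \<Longrightarrow> j < 4 \<Longrightarrow> f i \<rightarrow>\<^bsub>G\<^esub> f j \<longleftrightarrow> j = Suc i \<or> i = Suc j"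
    using assms unfolding contains_induced_with_proj_iff[OF path_graph_wf]
    by (auto simp: path_graph_def)
  have "nonadj G (f i) (f j) \<longleftrightarrow> i \<noteq> j \<and> j \<noteq> Suc i \<and> i \<noteq> Suc j" if "i < 4" "j < 4" for i j
    using that adj[OF that] inj_on_eq_iff[OF inj, of i j] im unfolding nonadj_def by auto
  then have "nonadj G (f 1) (f 3)" "nonadj G (f 3) (f 0)" "nonadj G (f 0) (f 2)"
    "\<not> nonadj G (f 1) (f 2)"
    by simp_all
  then show ?thesis unfolding co_three_walks_close_def by blast
qed

text \<open>
  The walks in question may repeat vertices, so distinctness has to be derived: a walk that turns
  back has adjacent ends in the complement, and a closed walk of length three is a triangle. The
  chords are edges of the given graph, again because there are no triangles in the complement.
\<close>

lemma (in graph) not_co_three_walks_close_imp: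
  assumes T: "co_triangle_free G" and "\<not> co_three_walks_close G"
  shows "contains_induced G (with_proj (path_graph 4))"
proof -
  obtain a b c d where N: "nonadj G a b" "nonadj G b c" "nonadj G c d" "\<not> nonadj G a d"
    using assms(2) unfolding co_three_walks_close_def by blast
  have "a \<noteq> c" "b \<noteq> d" using N by auto
  have "a \<noteq> d" using N T nonadj_sym unfolding co_triangle_free_def by blast
  have "\<not> nonadj G a c" "\<not> nonadj G b d" using N T unfolding co_triangle_free_def by blast+
  with N \<open>a \<noteq> c\<close> \<open>b \<noteq> d\<close> \<open>a \<noteq> d\<close>
  have E: "c \<rightarrow>\<^bsub>G\<^esub> a" "a \<rightarrow>\<^bsub>G\<^esub> c" "a \<rightarrow>\<^bsub>G\<^esub> d" "d \<rightarrow>\<^bsub>G\<^esub> a" "d \<rightarrow>\<^bsub>G\<^esub> b" "b \<rightarrow>\<^bsub>G\<^esub> d"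
    using adj_sym by (auto simp: nonadj_def)
  have NE: "\<not> a \<rightarrow>\<^bsub>G\<^esub> b" "\<not> b \<rightarrow>\<^bsub>G\<^esub> a" "\<not> b \<rightarrow>\<^bsub>G\<^esub> c" "\<not> c \<rightarrow>\<^bsub>G\<^esub> b" "\<not> c \<rightarrow>\<^bsub>G\<^esub> d" "\<not> d \<rightarrow>\<^bsub>G\<^esub> c"
    using N adj_sym by (auto simp: nonadj_def)
  have V: "a \<in> verts G" "b \<in> verts G" "c \<in> verts G" "d \<in> verts G"
    and D: "a \<noteq> b" "b \<noteq> c" "c \<noteq> d"
    using N by (auto simp: nonadj_def)
  have pV: "pverts (path_graph 4) = {0, 1, 2, 3}" by (auto simp: path_graph_def)
  \<comment> \<open>Complementing the path \<open>a, b, c, d\<close> gives the path \<open>c, a, d, b\<close>.\<close>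
  define f :: "nat \<Rightarrow> 'a" where "f i = [c, a, d, b] ! i" for i
  have f: "f 0 = c" "f (Suc 0) = a" "f 2 = d" "f 3 = b" by (simp_all add: f_def)
  have inj: "inj_on f {0, 1, 2, 3}"
    using D \<open>a \<noteq> c\<close> \<open>b \<noteq> d\<close> \<open>a \<noteq> d\<close> by (auto simp: f)
  show ?thesis
    unfolding contains_induced_with_proj_iff[OF path_graph_wf] pV
  proof (intro exI conjI)
    show "f ` {0, 1, 2, 3} \<subseteq> verts G" using V by (simp add: f)
    have "\<not> x \<rightarrow>\<^bsub>G\<^esub> x" for x using adj_not_same by blast
    then show "\<forall>i\<in>{0, 1, 2, 3}. \<forall>j\<in>{0, 1, 2, 3}.
        f i \<rightarrow>\<^bsub>G\<^esub> f j \<longleftrightarrow> (i, j) \<in> parcs (path_graph 4)"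
      using E NE by (simp add: f path_graph_def)
  qed (rule inj)
qed

lemma (in graph) forbidden_subgraphs_iff:
  "\<not> contains_induced G (with_proj (path_graph 4)) \<and>
    \<not> contains_induced G (with_proj (edgeless_graph 3)) \<longleftrightarrow>
    co_triangle_free G \<and> co_three_walks_close G"
  using contains_edgeless_3_iff contains_path_4_imp not_co_three_walks_close_imp by blast

section \<open>From a partition to the local conditions\<close>

text \<open>
  The value at \<open>Z_part\<close> makes this an involution on all parts; no vertex is non-adjacent to
  another one in the same part, so a fixed point means that there is no opposite part.
\<close>

fun opposite :: "part \<Rightarrow> part" where
  "opposite (X_part j) = Y_part j"
| "opposite (Y_part j) = X_part j"
| "opposite Z_part = Z_part"

lemma opposite_opposite [simp]: "opposite (opposite p) = p"
  by (cases p) auto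

lemma F_partition_nonadj_iff:
  assumes P: "F_partition k G P"
    and p: "p \<in> parts k" "u \<in> P p" and q: "q \<in> parts k" "v \<in> P q"
  shows "nonadj G u v \<longleftrightarrow> p \<noteq> q \<and> q = opposite p"
proof (cases "p = q")
  case True
  then show ?thesis
    using P p q unfolding F_partition_def clique_def nonadj_def by blast
next
  case False
  have disj: "r = s" if "r \<in> parts k" "s \<in> parts k" "w \<in> P r" "w \<in> P s" for r s w
    using P that unfolding F_partition_def disjoint_family_on_def by blast
  have V: "u \<in> verts G" "v \<in> verts G" using P p q unfolding F_partition_def by blast+
  have "u \<noteq> v" using disj p q False by blast
  have mem: "X_part j \<in> parts k" "Y_part j \<in> parts k" if "j \<in> {1..k}" for j
    using that unfolding parts_def by auto
  have "\<not> u \<rightarrow>\<^bsub>G\<^esub> v \<longleftrightarrow>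
      (\<exists>j\<in>{1..k}. u \<in> P (X_part j) \<and> v \<in> P (Y_part j) \<or> u \<in> P (Y_part j) \<and> v \<in> P (X_part j))"
    using P p q False unfolding F_partition_def by blast
  also have "\<dots> \<longleftrightarrow>
      (\<exists>j\<in>{1..k}. p = X_part j \<and> q = Y_part j \<or> p = Y_part j \<and> q = X_part j)"
    using p q disj mem by metis
  also have "\<dots> \<longleftrightarrow> q = opposite p"
    using p q False by (cases p) (auto simp: parts_def)
  finally show ?thesis using V \<open>u \<noteq> v\<close> False by (simp add: nonadj_def)
qed

lemma F_partition_imp_local:
  assumes P: "F_partition k G P"
  shows "co_triangle_free G" "co_three_walks_close G"
proof -
  have "\<forall>v\<in>verts G. \<exists>p. p \<in> parts k \<and> v \<in> P p"
    using P unfolding F_partition_def by blast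
  then obtain c where c: "\<And>v. v \<in> verts G \<Longrightarrow> c v \<in> parts k \<and> v \<in> P (c v)" by metis
  have N: "nonadj G u v \<longleftrightarrow>
      u \<in> verts G \<and> v \<in> verts G \<and> c u \<noteq> c v \<and> c v = opposite (c u)" for u v
    using F_partition_nonadj_iff[OF P] c unfolding nonadj_def by metis
  show "co_triangle_free G" "co_three_walks_close G"
    unfolding co_triangle_free_def co_three_walks_close_def N by (metis opposite_opposite)+
qed

section \<open>From the local conditions to a partition\<close>

lemma finite_transversal:
  assumes E: "equiv A E" and "finite A"
  obtains h and k :: nat where "h ` {1..k} \<subseteq> A"
    "\<And>v. v \<in> A \<Longrightarrow> \<exists>j\<in>{1..k}. (h j, v) \<in> E"
    "\<And>i j. i \<in> {1..k} \<Longrightarrow> j \<in> {1..k} \<Longrightarrow> (h i, h j) \<in> E \<Longrightarrow> i = j"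
proof -
  have "finite (A // E)" using assms by (simp add: finite_quotient equiv_type)
  then obtain q where q: "bij_betw q {1..card (A // E)} (A // E)"
    using ex_bij_betw_nat_finite_1 by blast
  define h where "h j = (SOME v. v \<in> q j)" for j
  have h: "h j \<in> q j" "q j \<in> A // E" if "j \<in> {1..card (A // E)}" for j
  proof -
    show "q j \<in> A // E" using q that by (auto simp: bij_betw_def)
    then have "q j \<noteq> {}" using E in_quotient_imp_non_empty by blast
    then show "h j \<in> q j" unfolding h_def by (simp add: some_in_eq)
  qed
  show thesis
  proof
    show "h ` {1..card (A // E)} \<subseteq> A"
      using h in_quotient_imp_subset[OF E] by blast
  next
    fix v assume v: "v \<in> A"
    then have "E `` {v} \<in> A // E" by (rule quotientI)
    then obtain j where j: "j \<in> {1..card (A // E)}" "q j = E `` {v}"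
      using q by (metis bij_betw_def imageE)
    then have "(v, h j) \<in> E" using h(1)[OF j(1)] by simp
    then show "\<exists>j\<in>{1..card (A // E)}. (h j, v) \<in> E"
      using E j by (meson equiv_def symE)
  next
    fix i j assume ij: "i \<in> {1..card (A // E)}" "j \<in> {1..card (A // E)}" "(h i, h j) \<in> E"
    then have "q i = q j" using quotient_eqI[OF E] h by metis
    then show "i = j" using q ij by (meson bij_betw_def inj_onD)
  qed
qed

text \<open>
  In a nontrivial component with representative \<open>a\<close>, the side opposite to \<open>a\<close> is the set of
  neighbours of \<open>a\<close> in the complement and the side of \<open>a\<close> is the set of ends of complement
  walks of length two from \<open>a\<close>. Longer walks reach nothing new, as three steps can be replaced
  by one.
\<close>

lemma (in graph) local_imp_F_partition:
  assumes T: "co_triangle_free G" and W: "co_three_walks_close G"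
  shows "\<exists>k P. F_partition k G P"
proof -
  define N where "N = nonadj G"
  define S where "S a w \<longleftrightarrow> (\<exists>u. N a u \<and> N u w)" for a w
  have tri: "\<not> (N a b \<and> N b c \<and> N a c)" for a b c
    using T unfolding N_def co_triangle_free_def by blast
  have walk: "N a d" if "N a b" "N b c" "N c d" for a b c d
    using W that unfolding N_def co_three_walks_close_def by blast
  have sym: "N u v \<longleftrightarrow> N v u" for u v unfolding N_def by (rule nonadj_sym)
  have V: "u \<in> verts G" "v \<in> verts G" if "N u v" for u v
    using that unfolding N_def nonadj_def by auto
  define A where "A = {v. \<exists>u. N v u}"
  have "A \<subseteq> verts G" using V unfolding A_def by blast
  then have "finite A" using finite_verts finite_subset by blast
  define E where "E = {(v, w). N v w \<or> S v w}"
  have "equiv A E"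
  proof (rule equivI)
    show "E \<subseteq> A \<times> A" using sym unfolding E_def S_def A_def by blast
    show "refl_on A E" using sym unfolding E_def S_def A_def refl_on_def by blast
    show "sym E" using sym unfolding E_def S_def sym_def by blast
    show "trans E" using walk unfolding E_def S_def trans_def by blast
  qed
  then obtain h and k :: nat where h: "h ` {1..k} \<subseteq> A"
    and cover: "\<And>v. v \<in> A \<Longrightarrow> \<exists>j\<in>{1..k}. (h j, v) \<in> E"
    and one: "\<And>i j. i \<in> {1..k} \<Longrightarrow> j \<in> {1..k} \<Longrightarrow> (h i, h j) \<in> E \<Longrightarrow> i = j"
    using \<open>finite A\<close> by (rule finite_transversal) blast
  have same: "i = j" if "i \<in> {1..k}" "j \<in> {1..k}" "(h i, w) \<in> E" "(h j, w) \<in> E" for i j w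
    using one that \<open>equiv A E\<close> by (meson equiv_def symE transE)
  define P where "P p = (case p of X_part j \<Rightarrow> {w. S (h j) w} | Y_part j \<Rightarrow> {w. N (h j) w}
    | Z_part \<Rightarrow> verts G - A)" for p
  have P: "P (X_part j) = {w. S (h j) w}" "P (Y_part j) = {w. N (h j) w}"
    "P Z_part = verts G - A" for j by (simp_all add: P_def)
  have SA: "w \<in> A" if "S a w" for a w using that sym unfolding S_def A_def by blast
  have NA: "w \<in> A" if "N a w" for a w using that sym unfolding A_def by blast
  have SN: False if "S a w" "N a w" for a w using that tri unfolding S_def by blast
  have "(\<Union>p\<in>parts k. P p) = verts G"
  proof (intro equalityI subsetI)
    fix w assume "w \<in> (\<Union>p\<in>parts k. P p)"
    then show "w \<in> verts G" using SA NA \<open>A \<subseteq> verts G\<close> by (auto simp: parts_def P)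
  next
    fix w assume "w \<in> verts G"
    then show "w \<in> (\<Union>p\<in>parts k. P p)"
      using cover[of w] unfolding parts_def E_def by (cases "w \<in> A") (auto simp: P)
  qed
  moreover have disj: "disjoint_family_on P (parts k)"
    unfolding disjoint_family_on_def
  proof (intro ballI impI equals0I)
    fix p q w assume pq: "p \<in> parts k" "q \<in> parts k" "p \<noteq> q" and w: "w \<in> P p \<inter> P q"
    then have wp: "w \<in> P p" and wq: "w \<in> P q" by simp_all
    \<comment> \<open>The part containing \<open>w\<close> can be recovered from \<open>w\<close> alone: the component of \<open>w\<close> gives the
      index, and adjacency to the representative in the complement gives the side.\<close>
    have Z: "r = Z_part" if "r \<in> parts k" "w \<in> P r" "w \<notin> A" for r
      using that SA NA by (cases r) (auto simp: P)
    have XY: "\<exists>j\<in>{1..k}. (h j, w) \<in> E \<and> r = (if N (h j) w then Y_part j else X_part j)"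
      if "r \<in> parts k" "w \<in> P r" "w \<in> A" for r
    proof (cases r)
      case (X_part j)
      moreover from this have "S (h j) w" "j \<in> {1..k}" using that by (auto simp: P parts_def)
      ultimately show ?thesis using SN unfolding E_def by (intro bexI[of _ j]) auto
    next
      case (Y_part j)
      moreover from this have "N (h j) w" "j \<in> {1..k}" using that by (auto simp: P parts_def)
      ultimately show ?thesis unfolding E_def by (intro bexI[of _ j]) auto
    next
      case Z_part
      then show ?thesis using that by (simp add: P)
    qed
    have "p = q"
    proof (cases "w \<in> A")
      case True
      obtain i where i: "i \<in> {1..k}" "(h i, w) \<in> E"
        and p: "p = (if N (h i) w then Y_part i else X_part i)"
        using XY[OF pq(1) wp True] by blast
      obtain j where j: "j \<in> {1..k}" "(h j, w) \<in> E"
        and q: "q = (if N (h j) w then Y_part j else X_part j)"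
        using XY[OF pq(2) wq True] by blast
      have "i = j" using same[OF i(1) j(1) i(2) j(2)] .
      then show ?thesis using p q by simp
    next
      case False
      show ?thesis using Z[OF pq(1) wp False] Z[OF pq(2) wq False] by simp
    qed
    with pq show False by simp
  qed
  moreover have "\<forall>p\<in>parts k. clique G (P p)"
  proof
    fix p assume "p \<in> parts k"
    have "P p \<subseteq> verts G" using SA NA \<open>A \<subseteq> verts G\<close> by (cases p) (auto simp: P)
    moreover have "\<not> N u v" if "u \<in> P p" "v \<in> P p" for u v
    proof (cases p)
      case (X_part j)
      then have uv: "S (h j) u" "S (h j) v" using that by (simp_all add: P)
      show ?thesis
      proof
        assume "N u v"
        then have "N (h j) v" using uv(1) walk unfolding S_def by blast
        then show False using uv(2) SN by blast
      qed
    next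
      case (Y_part j)
      then show ?thesis using that tri by (auto simp: P)
    next
      case Z_part
      then show ?thesis using that by (auto simp: P A_def)
    qed
    ultimately show "clique G (P p)" unfolding clique_def N_def nonadj_def by blast
  qed
  moreover have "\<forall>j\<in>{1..k}. P (X_part j) \<noteq> {} \<and> P (Y_part j) \<noteq> {}"
  proof
    fix j assume "j \<in> {1..k}"
    then have "h j \<in> A" using h by blast
    then obtain u where "N (h j) u" unfolding A_def by blast
    moreover from this have "S (h j) (h j)" using sym unfolding S_def by blast
    ultimately show "P (X_part j) \<noteq> {} \<and> P (Y_part j) \<noteq> {}" by (auto simp: P)
  qed
  moreover have "\<not> u \<rightarrow>\<^bsub>G\<^esub> v \<longleftrightarrow>
      (\<exists>j\<in>{1..k}. u \<in> P (X_part j) \<and> v \<in> P (Y_part j) \<or> u \<in> P (Y_part j) \<and> v \<in> P (X_part j))"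
      (is "_ \<longleftrightarrow> ?R")
    if pq: "p \<in> parts k" "q \<in> parts k" "p \<noteq> q" and u: "u \<in> P p" and v: "v \<in> P q" for p q u v
  proof -
    have "u \<noteq> v" using disj pq u v unfolding disjoint_family_on_def by blast
    moreover have "u \<in> verts G" "v \<in> verts G"
      using pq u v calculation \<open>(\<Union>p\<in>parts k. P p) = verts G\<close> by blast+
    ultimately have "\<not> u \<rightarrow>\<^bsub>G\<^esub> v \<longleftrightarrow> N u v" by (simp add: N_def nonadj_def)
    also have "N u v \<longleftrightarrow> ?R"
    proof
      assume uv: "N u v"
      then have "u \<in> A" unfolding A_def by blast
      then obtain j where j: "j \<in> {1..k}" "N (h j) u \<or> S (h j) u"
        using cover unfolding E_def by blast
      have "S (h j) v" if "N (h j) u" using that uv unfolding S_def by blast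
      moreover have "N (h j) v" if "S (h j) u" using that uv walk unfolding S_def by blast
      ultimately show ?R using j by (auto simp: P)
    next
      have "N x y \<and> N y x" if "S a x" "N a y" for a x y
        using that walk sym unfolding S_def by blast
      moreover assume ?R
      ultimately show "N u v" unfolding P mem_Collect_eq by blast
    qed
    finally show ?thesis .
  qed
  ultimately have "F_partition k G P" unfolding F_partition_def by blast
  then show ?thesis by blast
qed

section \<open>The characterization\<close>

theorem theorem1p3:
  fixes G :: "('a, 'b) pre_digraph"
  assumes "graph G"
  shows "G \<in> F_class \<longleftrightarrow>
    \<not> contains_induced G (with_proj (path_graph 4)) \<and>
    \<not> contains_induced G (with_proj (edgeless_graph 3))"
proof -
  interpret graph G by fact
  have "G \<in> F_class \<longleftrightarrow> (\<exists>k P. F_partition k G P)"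
    using assms by (simp add: F_class_def F_k_def)
  also have "\<dots> \<longleftrightarrow> co_triangle_free G \<and> co_three_walks_close G"
    using F_partition_imp_local local_imp_F_partition by blast
  finally show ?thesis by (simp only: forbidden_subgraphs_iff)
qed

end
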